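(* Let $1<p<\infty$ and $\alpha=\mu+i\nu\in\mathbb{C}\setminus\mathbb{Z}$ with $\mu,\nu\in\mathbb{R}$. Let $$\lambda(\alpha,p):=\inf_{\substack{u\in W^{1,p}(0,2\pi)\setminus\{0\}\\ u(0)=u(2\pi)}}\frac{\int_0^{2\pi}|\partial_\phi u-i\alpha u|^p\,d\phi}{\int_0^{2\pi}|u|^p\,d\phi}.$$ Then $$\left(\frac{|\nu|}{\sinh(\pi|\nu|)}\right)^{p}\bigl(\sin^2(\pi\mu)+\sinh^2(\pi\nu)\bigr)^{p/2}\ \le\ \lambda(\alpha,p)\ \le\ \operatorname{dist}(\alpha,\mathbb{Z})^p,$$ where for $\nu=0$ the quotient $|\nu|/\sinh(\pi|\nu|)$ is understood as its limit value $1/\pi$.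
   Context: $W^{1,p}(0,2\pi)$ is the Sobolev space of complex-valued functions on the interval $(0,2\pi)$; its elements have continuous representatives on $[0,2\pi]$, so the values $u(0)$ and $u(2\pi)$ are well defined. $\operatorname{dist}(\alpha,\mathbb{Z})=\min_{m\in\mathbb{Z}}|\alpha-m|$ denotes the distance in $\mathbb{C}$, so $\operatorname{dist}(\alpha,\mathbb{Z})^2=\operatorname{dist}(\mu,\mathbb{Z})^2+\nu^2$. *)

theory Defs
  imports "HOL-Analysis.Analysis"
begin

definition test_function :: "real \<Rightarrow> real \<Rightarrow> (real \<Rightarrow> real) \<Rightarrow> bool" where
  "test_function a b \<phi> \<longleftrightarrow>
     (\<forall>n x. (deriv ^^ n) \<phi> field_differentiable (at x)) \<and>
     compact (closure {x. \<phi> x \<noteq> 0}) \<and> closure {x. \<phi> x \<noteq> 0} \<subseteq> {a<..<b}"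

text \<open>Elements of \<open>L\<^sup>p\<close> are represented by functions, which are to be read
  modulo equality almost everywhere on the interval.\<close>

definition Lp :: "real \<Rightarrow> real \<Rightarrow> real \<Rightarrow> (real \<Rightarrow> complex) set" where
  "Lp p a b =
     {u. u \<in> borel_measurable (lebesgue_on {a<..<b}) \<and>
         integrable (lebesgue_on {a<..<b}) (\<lambda>x. cmod (u x) powr p)}"

text \<open>By linearity, testing against real-valued functions is the same as testing
  against complex-valued ones. The integrals are meaningful for locally integrable
  \<open>u\<close> and \<open>g\<close>, in particular for elements of \<open>L\<^sup>p\<close> with \<open>p \<ge> 1\<close>.\<close>

definition weak_derivative ::
    "real \<Rightarrow> real \<Rightarrow> (real \<Rightarrow> complex) \<Rightarrow> (real \<Rightarrow> complex) \<Rightarrow> bool" where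
  "weak_derivative a b u g \<longleftrightarrow>
     (\<forall>\<phi>. test_function a b \<phi> \<longrightarrow>
        (LINT x|lebesgue_on {a<..<b}. u x * of_real (deriv \<phi> x)) =
        - (LINT x|lebesgue_on {a<..<b}. g x * of_real (\<phi> x)))"

definition W1p :: "real \<Rightarrow> real \<Rightarrow> real \<Rightarrow> (real \<Rightarrow> complex) set" where
  "W1p p a b = {u \<in> Lp p a b. \<exists>g \<in> Lp p a b. weak_derivative a b u g}"

text \<open>Each Sobolev class enters through its continuous representative \<open>u\<close> on
  \<open>[0, 2\<pi>]\<close>; its weak derivative \<open>g\<close> is unique up to equality almost everywhere,
  so the quotient depends on \<open>u\<close> only.\<close>

definition lambda_inf :: "complex \<Rightarrow> real \<Rightarrow> real" where
  "lambda_inf \<alpha> p = Inf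
     {(LINT x|lebesgue_on {0<..<2*pi}. cmod (g x - \<i> * \<alpha> * u x) powr p) /
      (LINT x|lebesgue_on {0<..<2*pi}. cmod (u x) powr p) | u g.
        u \<in> W1p p 0 (2*pi) \<and> continuous_on {0..2*pi} u \<and>
        g \<in> Lp p 0 (2*pi) \<and> weak_derivative 0 (2*pi) u g \<and>
        \<not> (AE x in lebesgue_on {0<..<2*pi}. u x = 0) \<and>
        u 0 = u (2*pi)}"

end

theory Submission
  imports Defs
begin

text \<open>For the upper bound, test with the Fourier modes \<open>u = exp (\<i> m \<phi>)\<close>.

  For the lower bound put \<open>f = u' - \<i> \<alpha> u\<close> and \<open>q = exp (- 2 \<pi> \<i> \<alpha>)\<close>. The function
  \<open>w = exp (- \<i> \<alpha> \<phi>) u\<close> has the weak derivative \<open>exp (- \<i> \<alpha> \<phi>) f\<close> and satisfies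
  \<open>w (2 \<pi>) = q w 0\<close>, so integrating it over \<open>(0, x)\<close> and \<open>(x, 2 \<pi>)\<close> gives
  \<open>\<bar>q - 1\<bar> \<bar>u x\<bar> \<le> \<integral> K x y \<bar>f y\<bar> dy\<close>, where \<open>K x y = exp (\<nu> s)\<close> with \<open>s \<in> [0, 2 \<pi>]\<close> the
  distance from \<open>x\<close> forward to \<open>y\<close> on the circle. Both marginals of \<open>K\<close> equal
  \<open>C = \<integral> exp (\<nu> s) ds\<close> over \<open>[0, 2 \<pi>]\<close>, so the Schur test bounds the
  \<open>L\<^sup>p\<close> norms by \<open>\<bar>q - 1\<bar> \<parallel>u\<parallel> \<le> C \<parallel>f\<parallel>\<close>, and \<open>\<bar>q - 1\<bar> / C\<close> is the asserted constant.

  The integral formula for \<open>w\<close> follows by testing the weak derivative against smooth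
  approximations of the indicator function of an interval.\<close>

section \<open>Smooth functions and test functions\<close>

definition smooth :: "(real \<Rightarrow> real) \<Rightarrow> bool" where
  "smooth f \<longleftrightarrow> (\<forall>n x. (deriv ^^ n) f field_differentiable (at x))"

lemma test_function_iff_smooth:
  "test_function a b \<phi> \<longleftrightarrow>
     smooth \<phi> \<and> compact (closure {x. \<phi> x \<noteq> 0}) \<and> closure {x. \<phi> x \<noteq> 0} \<subseteq> {a<..<b}"
  by (simp add: test_function_def smooth_def)

text \<open>A class in which every member has a derivative belonging to the class contains all
  iterated derivatives of its members, because derivatives are unique. Smoothness thus reduces to
  one differentiation step, with no formula for \<open>(deriv ^^ n) f\<close>.\<close>

lemma smooth_coinduct:
  assumes "C f"
    and step: "\<And>h. C h \<Longrightarrow> \<exists>h'. C h' \<and> (\<forall>x. (h has_real_derivative h' x) (at x))"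
  shows "smooth f"
proof -
  have diff: "h field_differentiable (at x)" if "C h" for h x
    using step[OF that] by (auto simp: field_differentiable_def)
  have "C (deriv h)" if "C h" for h
  proof -
    from step[OF that] obtain h' where h': "C h'" "\<And>x. (h has_real_derivative h' x) (at x)"
      by blast
    then have "deriv h = h'" by (intro ext DERIV_imp_deriv)
    then show ?thesis using h' by simp
  qed
  then have "C ((deriv ^^ n) f)" for n
    by (induction n) (use \<open>C f\<close> in auto)
  then show ?thesis
    unfolding smooth_def using diff by blast
qed

lemma smooth_DERIV: "smooth f \<Longrightarrow> (f has_real_derivative deriv f x) (at x)"
  unfolding smooth_def by (drule spec[of _ 0]) (simp add: DERIV_deriv_iff_field_differentiable)

lemma smooth_deriv: "smooth f \<Longrightarrow> smooth (deriv f)"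
  unfolding smooth_def
proof (intro allI)
  fix n x assume "\<forall>n x. (deriv ^^ n) f field_differentiable (at x)"
  then show "(deriv ^^ n) (deriv f) field_differentiable (at x)"
    by (auto dest: spec[of _ "Suc n"] simp: funpow_swap1)
qed

lemma smooth_continuous_on: "smooth f \<Longrightarrow> continuous_on A f"
  by (intro continuous_at_imp_continuous_on ballI DERIV_isCont[OF smooth_DERIV])

section \<open>Functions that are flat at the origin\<close>

text \<open>\<open>flat 0\<close> is the classical exp(-1/x) extended by zero. The powers of 1/x are
  carried along because differentiation produces them: derivatives of the family are linear
  combinations of its members.\<close>

definition flat :: "nat \<Rightarrow> real \<Rightarrow> real" where
  "flat k x = (if x \<le> 0 then 0 else inverse x ^ k / exp (inverse x))"

lemma flat_nonneg: "0 \<le> flat k x"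
  by (simp add: flat_def)

lemma flat_pos: "0 < x \<Longrightarrow> 0 < flat k x"
  by (simp add: flat_def)

lemma flat_eq_0: "x \<le> 0 \<Longrightarrow> flat k x = 0"
  by (simp add: flat_def)

text \<open>On the right, t = 1/x turns the claim into the decay of t^k / exp t at infinity; on the
  left the function vanishes.\<close>

lemma flat_tendsto_0: "(flat k \<longlongrightarrow> 0) (at 0)"
proof -
  have "((\<lambda>x. inverse x ^ k / exp (inverse x)) \<longlongrightarrow> (0::real)) (at_right 0)"
    by (rule filterlim_compose[OF tendsto_power_div_exp_0 filterlim_inverse_at_top_right])
  then have "(flat k \<longlongrightarrow> 0) (at_right 0)"
    by (rule Lim_transform_eventually)
       (auto simp: flat_def eventually_at_filter intro!: always_eventually)
  moreover have "(flat k \<longlongrightarrow> 0) (at_left 0)"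
    by (rule Lim_transform_eventually[OF tendsto_const])
       (auto simp: flat_def eventually_at_filter intro!: always_eventually)
  ultimately show ?thesis
    by (simp add: filterlim_split_at)
qed

lemma flat_DERIV:
  "(flat k has_real_derivative flat (k + 2) x - of_nat k * flat (k + 1) x) (at x)"
proof -
  consider "x < 0" | "x = 0" | "x > 0" by linarith
  then show ?thesis
  proof cases
    case 1
    have "((\<lambda>_. 0) has_real_derivative 0) (at x)" by simp
    then have "(flat k has_real_derivative 0) (at x)"
      by (rule has_field_derivative_transform_within_open[of _ _ _ "{..<0}"])
         (use 1 in \<open>auto simp: flat_def\<close>)
    then show ?thesis using 1 by (simp add: flat_def)
  next
    case 2
    \<comment> \<open>Dividing by h raises the power of 1/h by one, so the difference quotient at 0
      is \<open>flat (k + 1) h\<close>, whose limit is already known.\<close>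
    have "((\<lambda>h. (flat k (0 + h) - flat k 0) / h) \<longlongrightarrow> 0) (at 0)"
      by (rule Lim_transform_eventually[OF flat_tendsto_0[of "k + 1"]])
         (auto simp: flat_def eventually_at_filter field_simps intro!: always_eventually)
    then show ?thesis
      using 2 by (simp add: DERIV_def flat_def)
  next
    case 3
    have "((\<lambda>x. inverse x ^ k * exp (- inverse x)) has_real_derivative
        flat (k + 2) x - of_nat k * flat (k + 1) x) (at x)"
    proof (cases k)
      case 0
      then show ?thesis using 3
        by (auto intro!: derivative_eq_intros simp: flat_def exp_minus field_simps power2_eq_square)
    next
      case (Suc j)
      have "((\<lambda>x. inverse x ^ Suc j) has_real_derivative
          (1 + of_nat j) * (- (inverse x * inverse x) * inverse x ^ j)) (at x)"
        using DERIV_power_Suc[OF DERIV_inverse, of x j UNIV] 3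
        by (simp add: power2_eq_square)
      moreover have "((\<lambda>x. exp (- inverse x)) has_real_derivative
          exp (- inverse x) * (inverse x * inverse x)) (at x)"
        using 3 by (auto intro!: derivative_eq_intros simp: power2_eq_square)
      ultimately show ?thesis unfolding Suc
        by (rule DERIV_cong[OF DERIV_mult])
           (use 3 in \<open>simp add: flat_def exp_minus divide_inverse algebra_simps\<close>)
    qed
    then show ?thesis
      by (rule has_field_derivative_transform_within_open[of _ _ _ "{0<..}"])
         (use 3 in \<open>auto simp: flat_def exp_minus field_simps\<close>)
  qed
qed

text \<open>Each generated function has a generated derivative, so the generated class
  consists of smooth functions; this yields all closure properties at once.\<close>

inductive smooth_gen :: "(real \<Rightarrow> real) \<Rightarrow> bool" where
  base: "smooth f \<Longrightarrow> smooth_gen f"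
| const: "smooth_gen (\<lambda>_. c)"
| flat: "smooth_gen (flat k)"
| exp: "smooth_gen exp"
| sin: "smooth_gen sin"
| add: "smooth_gen f \<Longrightarrow> smooth_gen g \<Longrightarrow> smooth_gen (\<lambda>x. f x + g x)"
| mult: "smooth_gen f \<Longrightarrow> smooth_gen g \<Longrightarrow> smooth_gen (\<lambda>x. f x * g x)"
| inverse: "smooth_gen f \<Longrightarrow> (\<And>x. f x \<noteq> 0) \<Longrightarrow> smooth_gen (\<lambda>x. inverse (f x))"
| affine: "smooth_gen f \<Longrightarrow> smooth_gen (\<lambda>x. f (a * x + b))"

lemma smooth_gen_DERIV:
  "smooth_gen f \<Longrightarrow> \<exists>f'. smooth_gen f' \<and> (\<forall>x. (f has_real_derivative f' x) (at x))"
proof (induction rule: smooth_gen.induct)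
  case (base f)
  then show ?case
    by (intro exI[of _ "deriv f"]) (simp add: smooth_DERIV smooth_deriv smooth_gen.base)
next
  case (const c)
  show ?case by (intro exI[of _ "\<lambda>_. 0"]) (auto intro: smooth_gen.const)
next
  case (flat k)
  have "smooth_gen (\<lambda>x. flat (k + 2) x + (- of_nat k) * flat (k + 1) x)"
    by (intro smooth_gen.add smooth_gen.mult smooth_gen.flat smooth_gen.const)
  then show ?case using flat_DERIV[of k] by fastforce
next
  case exp
  show ?case by (intro exI[of _ exp]) (auto intro: smooth_gen.exp)
next
  case sin
  \<comment> \<open>The derivative cos lies in the class as a translate of sin.\<close>
  have "smooth_gen (\<lambda>x. sin (1 * x + pi / 2))"
    by (intro smooth_gen.affine smooth_gen.sin)
  moreover have "(\<lambda>x::real. sin (1 * x + pi / 2)) = cos"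
    by (simp add: sin_add fun_eq_iff)
  ultimately have "smooth_gen cos"
    by simp
  then show ?case by (intro exI[of _ cos]) auto
next
  case (add f g)
  then obtain f' g' where "smooth_gen f'" "smooth_gen g'"
    "\<And>x. (f has_real_derivative f' x) (at x)" "\<And>x. (g has_real_derivative g' x) (at x)"
    by blast
  then show ?case
    by (intro exI[of _ "\<lambda>x. f' x + g' x"]) (auto intro!: smooth_gen.add DERIV_add)
next
  case (mult f g)
  then obtain f' g' where "smooth_gen f'" "smooth_gen g'"
    "\<And>x. (f has_real_derivative f' x) (at x)" "\<And>x. (g has_real_derivative g' x) (at x)"
    by blast
  with mult.hyps show ?case
    by (intro exI[of _ "\<lambda>x. f x * g' x + f' x * g x"])
       (auto intro!: smooth_gen.add smooth_gen.mult DERIV_mult')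
next
  case (inverse f)
  then obtain f' where "smooth_gen f'" "\<And>x. (f has_real_derivative f' x) (at x)"
    by blast
  with inverse.hyps show ?case
    by (intro exI[of _ "\<lambda>x. (-1) * (inverse (f x) * f' x * inverse (f x))"] conjI allI
          smooth_gen.mult smooth_gen.const smooth_gen.inverse DERIV_cong[OF DERIV_inverse'])
       auto
next
  case (affine f a b)
  then obtain f' where f': "smooth_gen f'" "\<And>x. (f has_real_derivative f' x) (at x)"
    by blast
  have "((\<lambda>x. f (a * x + b)) has_real_derivative f' (a * x + b) * a) (at x)" for x
    by (rule DERIV_chain2[OF f'(2)]) (auto intro!: derivative_eq_intros)
  with f'(1) show ?case
    by (intro exI[of _ "\<lambda>x. f' (a * x + b) * a"])
       (auto intro!: smooth_gen.mult smooth_gen.const smooth_gen.affine)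
qed

lemma smooth_gen_iff_smooth: "smooth_gen f \<longleftrightarrow> smooth f"
proof
  show "smooth_gen f \<Longrightarrow> smooth f"
    by (rule smooth_coinduct[of smooth_gen, OF _ smooth_gen_DERIV])
qed (rule smooth_gen.base)

lemmas smooth_intros =
  smooth_gen.const[unfolded smooth_gen_iff_smooth]
  smooth_gen.flat[unfolded smooth_gen_iff_smooth]
  smooth_gen.add[unfolded smooth_gen_iff_smooth]
  smooth_gen.mult[unfolded smooth_gen_iff_smooth]
  smooth_gen.inverse[unfolded smooth_gen_iff_smooth]

lemmas smooth_affine = smooth_gen.affine[unfolded smooth_gen_iff_smooth]
lemmas smooth_exp = smooth_gen.exp[unfolded smooth_gen_iff_smooth]
lemmas smooth_sin = smooth_gen.sin[unfolded smooth_gen_iff_smooth]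

lemma smooth_diff: "smooth f \<Longrightarrow> smooth g \<Longrightarrow> smooth (\<lambda>x. f x - g x)"
  using smooth_intros(3)[OF _ smooth_intros(4)[OF smooth_intros(1)[of "-1"]], of f g] by simp

section \<open>Products and supports of test functions\<close>

text \<open>A product vanishes wherever \<phi> does, so its support stays inside that of \<phi>.
  This permits testing a weak derivative against \<phi> times the real and imaginary parts of an
  exponential.\<close>

lemma test_function_mult:
  assumes "smooth f" "test_function a b \<phi>"
  shows "test_function a b (\<lambda>x. f x * \<phi> x)"
proof -
  have sub: "closure {x. f x * \<phi> x \<noteq> 0} \<subseteq> closure {x. \<phi> x \<noteq> 0}"
    by (rule closure_mono) auto
  then have "compact (closure {x. f x * \<phi> x \<noteq> 0})"
    using assms(2) unfolding test_function_iff_smooth compact_closure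
    by (auto elim: bounded_subset)
  then show ?thesis
    using assms sub unfolding test_function_iff_smooth by (blast intro: smooth_intros(4))
qed

lemma test_functionI:
  assumes "smooth \<phi>" "\<And>x. x \<notin> {c..d} \<Longrightarrow> \<phi> x = 0" "a < c" "d < b"
  shows "test_function a b \<phi>"
proof -
  have sub: "closure {x. \<phi> x \<noteq> 0} \<subseteq> {c..d}"
    by (rule closure_minimal) (use assms(2) in \<open>blast, simp\<close>)
  then have "compact (closure {x. \<phi> x \<noteq> 0})"
    using bounded_subset[OF bounded_closed_interval] closure_subset
    unfolding compact_closure by (meson order_trans)
  moreover have "{c..d} \<subseteq> {a<..<b}"
    using assms(3,4) by auto
  ultimately show ?thesis
    using assms(1) sub unfolding test_function_iff_smooth by blast
qed

lemma test_function_eq_0: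
  assumes "test_function a b \<phi>" "x \<notin> {a<..<b}"
  shows "\<phi> x = 0"
proof -
  have "{x. \<phi> x \<noteq> 0} \<subseteq> {a<..<b}"
    using assms(1) closure_subset[of "{x. \<phi> x \<noteq> 0}"] unfolding test_function_def
    by (meson order_trans)
  with assms(2) show ?thesis by auto
qed

section \<open>A monotone smooth transition from 0 to 1\<close>

definition smooth_step :: "real \<Rightarrow> real" where
  "smooth_step x = flat 0 x * inverse (flat 0 x + flat 0 (1 - x))"

text \<open>The numbers x and 1 - x are never both nonpositive. Hence the denominator of
  \<open>smooth_step\<close> has no zero.\<close>

lemma flat_sum_pos: "0 < flat 0 x + flat 0 (1 - x)"
proof (cases "0 < x")
  case True
  then show ?thesis by (intro add_pos_nonneg flat_pos flat_nonneg)
next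
  case False
  then show ?thesis by (intro add_nonneg_pos flat_pos flat_nonneg) simp
qed

lemma smooth_smooth_step: "smooth smooth_step"
proof -
  have "smooth (\<lambda>x. flat 0 (1 - x))"
    using smooth_affine[OF smooth_intros(2)[of 0], of "-1" 1] by (simp add: algebra_simps)
  moreover have "flat 0 x + flat 0 (1 - x) \<noteq> 0" for x
    using flat_sum_pos[of x] by simp
  ultimately show ?thesis
    unfolding smooth_step_def[abs_def] by (intro smooth_intros)
qed

lemma smooth_step_eq_0: "x \<le> 0 \<Longrightarrow> smooth_step x = 0"
  by (simp add: smooth_step_def flat_eq_0)

lemma smooth_step_eq_1: "1 \<le> x \<Longrightarrow> smooth_step x = 1"
  using flat_pos[of x 0] by (simp add: smooth_step_def flat_eq_0)

lemma smooth_step_bounds: "0 \<le> smooth_step x" "smooth_step x \<le> 1"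
  using flat_sum_pos[of x] flat_nonneg[of 0 x] flat_nonneg[of 0 "1 - x"]
  by (simp_all add: smooth_step_def flip: divide_inverse)

text \<open>The derivative of \<open>flat 0\<close> is \<open>flat 2\<close>, and in the numerator
  of the quotient rule the terms \<open>flat 2 x * flat 0 x\<close> cancel, leaving products of
  nonnegative functions. The sign is what makes derivatives of ramps usable as averaging
  weights.\<close>

lemma deriv_smooth_step_nonneg: "0 \<le> deriv smooth_step x"
proof -
  have 1: "(flat 0 has_real_derivative flat 2 x) (at x)"
    using flat_DERIV[of 0 x] by (simp add: numeral_2_eq_2)
  have "(flat 0 has_real_derivative flat 2 (1 - x)) (at (1 - x))"
    using flat_DERIV[of 0 "1 - x"] by (simp add: numeral_2_eq_2)
  then have 2: "((\<lambda>x. flat 0 (1 - x)) has_real_derivative flat 2 (1 - x) * (-1)) (at x)"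
    by (rule DERIV_chain2) (auto intro!: derivative_eq_intros)
  have "((\<lambda>x. flat 0 x / (flat 0 x + flat 0 (1 - x))) has_real_derivative
      (flat 2 x * (flat 0 x + flat 0 (1 - x)) - flat 0 x * (flat 2 x + flat 2 (1 - x) * (-1))) /
      ((flat 0 x + flat 0 (1 - x)) * (flat 0 x + flat 0 (1 - x)))) (at x)"
    by (intro DERIV_divide 1 DERIV_add 2) (use flat_sum_pos[of x] in simp)
  then have "deriv smooth_step x =
      (flat 2 x * (flat 0 x + flat 0 (1 - x)) - flat 0 x * (flat 2 x + flat 2 (1 - x) * (-1))) /
      ((flat 0 x + flat 0 (1 - x)) * (flat 0 x + flat 0 (1 - x)))"
    unfolding smooth_step_def[abs_def] divide_inverse[symmetric] by (rule DERIV_imp_deriv)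
  also have "\<dots> = (flat 2 x * flat 0 (1 - x) + flat 0 x * flat 2 (1 - x)) /
      ((flat 0 x + flat 0 (1 - x)) * (flat 0 x + flat 0 (1 - x)))"
    by (simp add: algebra_simps)
  also have "\<dots> \<ge> 0"
    by (intro divide_nonneg_nonneg add_nonneg_nonneg mult_nonneg_nonneg flat_nonneg)
  finally show ?thesis .
qed

section \<open>Weak derivatives of continuous functions\<close>

lemma lmeasurable_Ioo: "{a<..<b::real} \<in> lmeasurable"
  by (metis box_real(1) lmeasurable_box)

lemma borel_measurable_continuous_Ioo:
  fixes f :: "real \<Rightarrow> 'a::euclidean_space"
  assumes "continuous_on {a..b} f"
  shows "f \<in> borel_measurable (lebesgue_on {a<..<b})"
  by (rule continuous_imp_measurable_on_sets_lebesgue)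
     (auto intro: continuous_on_subset[OF assms] greaterThanLessThan_subseteq_atLeastAtMost_iff[THEN iffD2])

lemma continuous_on_Icc_norm_bounded:
  fixes f :: "real \<Rightarrow> 'a::real_normed_vector"
  assumes "continuous_on {a..b} f"
  obtains B where "\<And>x. x \<in> {a..b} \<Longrightarrow> norm (f x) \<le> B"
  using compact_imp_bounded[OF compact_continuous_image[OF assms compact_Icc]]
  unfolding bounded_iff by blast

lemma integrable_mult_bounded_Ioo:
  fixes f g :: "real \<Rightarrow> 'a::{real_normed_algebra, euclidean_space}"
  assumes "integrable (lebesgue_on {a<..<b}) g"
    and "f \<in> borel_measurable (lebesgue_on {a<..<b})"
    and "\<And>x. x \<in> {a<..<b} \<Longrightarrow> norm (f x) \<le> B"
  shows "integrable (lebesgue_on {a<..<b}) (\<lambda>x. g x * f x)"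
proof (rule Bochner_Integration.integrable_bound)
  show "integrable (lebesgue_on {a<..<b}) (\<lambda>x. norm (g x) * B)"
    using assms(1) by simp
  show "(\<lambda>x. g x * f x) \<in> borel_measurable (lebesgue_on {a<..<b})"
    using assms by measurable
  show "AE x in lebesgue_on {a<..<b}. norm (g x * f x) \<le> norm (norm (g x) * B)"
  proof (rule AE_I2)
    fix x assume "x \<in> space (lebesgue_on {a<..<b})"
    then have "norm (g x) * norm (f x) \<le> norm (g x) * B"
      by (intro mult_left_mono assms(3)) auto
    then show "norm (g x * f x) \<le> norm (norm (g x) * B)"
      using norm_mult_ineq[of "g x" "f x"] by simp
  qed
qed

lemma integrable_mult_continuous_Ioo:
  fixes f g :: "real \<Rightarrow> 'a::{real_normed_algebra, euclidean_space}"
  assumes "integrable (lebesgue_on {a<..<b}) g" "continuous_on {a..b} f"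
  shows "integrable (lebesgue_on {a<..<b}) (\<lambda>x. g x * f x)"
proof -
  obtain B where "\<And>x. x \<in> {a..b} \<Longrightarrow> norm (f x) \<le> B"
    using continuous_on_Icc_norm_bounded[OF assms(2)] by blast
  then show ?thesis
    by (intro integrable_mult_bounded_Ioo[where B = B] assms borel_measurable_continuous_Ioo) auto
qed

lemma integrable_const_Ioo: "integrable (lebesgue_on {a<..<b::real}) (\<lambda>_. c)"
  using finite_measure.integrable_const[OF finite_measure_lebesgue_on[OF lmeasurable_Ioo]] .

lemma integrable_continuous_Ioo:
  fixes f :: "real \<Rightarrow> 'a::euclidean_space"
  assumes "continuous_on {a..b} f"
  shows "integrable (lebesgue_on {a<..<b}) f"
proof -
  obtain B where "\<And>x. x \<in> {a..b} \<Longrightarrow> norm (f x) \<le> B"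
    using continuous_on_Icc_norm_bounded[OF assms] by blast
  then show ?thesis
    by (intro Bochner_Integration.integrable_bound[OF integrable_const_Ioo[of a b B]]
          borel_measurable_continuous_Ioo assms AE_I2)
       (auto intro: order_trans[OF _ abs_ge_self])
qed

text \<open>Endpoints are negligible, so a Lebesgue integral over the open interval can be evaluated
  by gauge integration over the closed one.\<close>

lemma LINT_Ioo_eq:
  fixes f :: "real \<Rightarrow> 'a::euclidean_space"
  assumes "integrable (lebesgue_on {a<..<b}) f" "(f has_integral I) {a..b}"
  shows "(LINT x|lebesgue_on {a<..<b}. f x) = I"
proof -
  have "(f has_integral (LINT x|lebesgue_on {a<..<b}. f x)) {a<..<b}"
    by (rule has_integral_integral_lebesgue_on[OF assms(1)]) simp
  moreover have "(f has_integral I) {a<..<b}"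
    using assms(2) by (simp add: has_integral_Icc_iff_Ioo)
  ultimately show ?thesis by (rule has_integral_unique)
qed

lemma LINT_Ioo_FTC:
  fixes f :: "real \<Rightarrow> 'a::euclidean_space"
  assumes "a \<le> b" "continuous_on {a..b} f"
    and "\<And>x. x \<in> {a..b} \<Longrightarrow> (F has_vector_derivative f x) (at x)"
  shows "(LINT x|lebesgue_on {a<..<b}. f x) = F b - F a"
  by (intro LINT_Ioo_eq integrable_continuous_Ioo fundamental_theorem_of_calculus assms
        has_vector_derivative_at_within[OF assms(3)])

section \<open>Ramps and their derivatives as an approximate identity\<close>

text \<open>The rescaled transition that rises from 0 at l to 1 at l + e; the argument has the form
  a * x + b expected by \<open>smooth_affine\<close>.\<close>

definition ramp :: "real \<Rightarrow> real \<Rightarrow> real \<Rightarrow> real" where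
  "ramp l e x = smooth_step (inverse e * x + (- l / e))"

lemma ramp_eq_0: "e > 0 \<Longrightarrow> x \<le> l \<Longrightarrow> ramp l e x = 0"
  unfolding ramp_def by (rule smooth_step_eq_0) (simp add: field_simps)

lemma ramp_eq_1: "e > 0 \<Longrightarrow> l + e \<le> x \<Longrightarrow> ramp l e x = 1"
  unfolding ramp_def by (rule smooth_step_eq_1) (simp add: field_simps)

lemma smooth_ramp: "smooth (ramp l e)"
  unfolding ramp_def[abs_def] by (intro smooth_affine smooth_smooth_step)

lemma ramp_bounds: "0 \<le> ramp l e x" "ramp l e x \<le> 1"
  unfolding ramp_def by (rule smooth_step_bounds)+

lemma deriv_ramp_nonneg:
  assumes "e > 0"
  shows "0 \<le> deriv (ramp l e) x"
proof -
  have "((\<lambda>x. smooth_step (inverse e * x + (- l / e))) has_real_derivative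
      deriv smooth_step (inverse e * x + (- l / e)) * inverse e) (at x)"
    by (rule DERIV_chain2[OF smooth_DERIV[OF smooth_smooth_step]])
       (auto intro!: derivative_eq_intros)
  then have "deriv (ramp l e) x = deriv smooth_step (inverse e * x + (- l / e)) * inverse e"
    unfolding ramp_def[abs_def] by (rule DERIV_imp_deriv)
  then show ?thesis
    using assms deriv_smooth_step_nonneg by simp
qed

lemma deriv_ramp_eq_0:
  assumes "e > 0" "x \<notin> {l..l + e}"
  shows "deriv (ramp l e) x = 0"
proof (rule DERIV_imp_deriv)
  consider "x < l" | "x > l + e" using assms by force
  then show "(ramp l e has_real_derivative 0) (at x)"
  proof cases
    case 1
    show ?thesis
      by (rule has_field_derivative_transform_within_open[OF DERIV_const, of "{..<l}" _ 0])
         (use 1 assms in \<open>auto simp: ramp_eq_0\<close>)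
  next
    case 2
    show ?thesis
      by (rule has_field_derivative_transform_within_open[OF DERIV_const, of "{l + e<..}" _ 1])
         (use 2 assms in \<open>auto simp: ramp_eq_1\<close>)
  qed
qed

lemma LINT_deriv_ramp:
  assumes "e > 0" "a \<le> l" "l + e \<le> b"
  shows "(LINT x|lebesgue_on {a<..<b}. deriv (ramp l e) x) = 1"
proof -
  have "(LINT x|lebesgue_on {a<..<b}. deriv (ramp l e) x) = ramp l e b - ramp l e a"
    using assms smooth_ramp
    by (intro LINT_Ioo_FTC smooth_continuous_on smooth_deriv)
       (auto simp flip: has_real_derivative_iff_has_vector_derivative intro: smooth_DERIV)
  then show ?thesis using assms by (simp add: ramp_eq_0 ramp_eq_1)
qed

text \<open>The derivatives of the ramps are nonnegative, have integral 1 and live on intervals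
  shrinking to c, so they act in the limit as a point mass at c on the continuous v.\<close>

lemma LINT_mult_deriv_ramp_tendsto:
  fixes v :: "real \<Rightarrow> complex"
  assumes v: "continuous_on {a..b} v" and c: "c \<in> {a..b}"
    and e: "\<And>n. e n > 0" "e \<longlonglongrightarrow> 0" and l: "l \<longlonglongrightarrow> c"
    and sub: "\<And>n. a \<le> l n" "\<And>n. l n + e n \<le> b"
  shows "(\<lambda>n. LINT x|lebesgue_on {a<..<b}. v x * of_real (deriv (ramp (l n) (e n)) x)) \<longlonglongrightarrow> v c"
proof (rule LIMSEQ_I)
  fix r :: real assume "r > 0"
  let ?M = "lebesgue_on {a<..<b}"
  let ?\<beta> = "\<lambda>n. deriv (ramp (l n) (e n))"
  obtain \<delta> where \<delta>: "\<delta> > 0" "\<And>x. x \<in> {a..b} \<Longrightarrow> dist x c < \<delta> \<Longrightarrow> dist (v x) (v c) < r / 2"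
    using v c \<open>r > 0\<close> unfolding continuous_on_iff by (meson half_gt_zero)
  have "(\<lambda>n. l n + e n) \<longlonglongrightarrow> c + 0"
    using l e(2) by (rule tendsto_add)
  then have "\<forall>\<^sub>F n in sequentially. dist (l n + e n) c < \<delta>"
    using \<delta>(1) tendstoD by fastforce
  moreover have "\<forall>\<^sub>F n in sequentially. dist (l n) c < \<delta>"
    using \<delta>(1) l tendstoD by blast
  ultimately have "\<forall>\<^sub>F n in sequentially.
      norm ((LINT x|?M. v x * of_real (?\<beta> n x)) - v c) < r"
  proof eventually_elim
    case (elim n)
    have cont: "continuous_on {a..b} (?\<beta> n)"
      by (intro smooth_continuous_on smooth_deriv smooth_ramp)
    have int: "integrable ?M (?\<beta> n)" "integrable ?M (\<lambda>x. complex_of_real (?\<beta> n x))"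
      "integrable ?M (\<lambda>x. v x * of_real (?\<beta> n x))"
      "integrable ?M (\<lambda>x. v c * of_real (?\<beta> n x))"
      by (intro integrable_continuous_Ioo continuous_intros v cont)+
    \<comment> \<open>Unit mass lets \<open>v c\<close> be written as an integral against the same
      weight, so the difference becomes an average of \<open>v x - v c\<close>.\<close>
    have 1: "(LINT x|?M. complex_of_real (?\<beta> n x)) = 1"
      using LINT_deriv_ramp[OF e(1) sub] by simp
    have "(LINT x|?M. v x * of_real (?\<beta> n x)) - v c =
        (LINT x|?M. v x * of_real (?\<beta> n x)) - (LINT x|?M. v c * of_real (?\<beta> n x))"
      using 1 by simp
    also have "\<dots> = (LINT x|?M. v x * of_real (?\<beta> n x) - v c * of_real (?\<beta> n x))"
      using int by simp
    also have "norm \<dots> \<le> (LINT x|?M. r / 2 * ?\<beta> n x)"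
    proof (rule Bochner_Integration.integral_norm_bound_integral)
      fix x assume x: "x \<in> space ?M"
      have nn: "0 \<le> ?\<beta> n x" using deriv_ramp_nonneg[OF e(1)] .
      have "norm (v x - v c) * ?\<beta> n x \<le> r / 2 * ?\<beta> n x"
      proof (cases "x \<in> {l n..l n + e n}")
        case True
        then have "dist x c < \<delta>" using elim by (auto simp: dist_real_def)
        then have "norm (v x - v c) \<le> r / 2"
          using \<delta>(2)[of x] x by (simp add: dist_norm)
        then show ?thesis using nn by (rule mult_right_mono)
      next
        case False
        then show ?thesis by (simp add: deriv_ramp_eq_0[OF e(1)])
      qed
      then show "norm (v x * of_real (?\<beta> n x) - v c * of_real (?\<beta> n x)) \<le> r / 2 * ?\<beta> n x"
        using nn by (simp add: norm_mult flip: left_diff_distrib)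
    qed (use int in simp_all)
    also have "\<dots> = r / 2"
      using LINT_deriv_ramp[OF e(1) sub] by simp
    finally show ?case using \<open>r > 0\<close> by simp
  qed
  then show "\<exists>no. \<forall>n\<ge>no. norm ((LINT x|?M. v x * of_real (?\<beta> n x)) - v c) < r"
    by (simp add: eventually_sequentially)
qed

section \<open>The fundamental theorem and the product rule for weak derivatives\<close>

text \<open>The weak derivative is tested against smooth approximations of the indicator of (c, d).
  On the left their derivatives concentrate at c and d with opposite signs; on the right dominated
  convergence applies.\<close>

lemma weak_derivative_FTC:
  fixes w F :: "real \<Rightarrow> complex"
  assumes wd: "weak_derivative a b w F" and w: "continuous_on {a..b} w"
    and F: "integrable (lebesgue_on {a<..<b}) F" and cd: "a \<le> c" "c < d" "d \<le> b"
  shows "w d - w c = (LINT x|lebesgue_on {a<..<b}. F x * indicator {c<..<d} x)"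
proof -
  let ?M = "lebesgue_on {a<..<b}"
  \<comment> \<open>The factor 1/4 gives c + 2e \<le> d - 2e, so the rising and the falling ramp do
    not overlap.\<close>
  define e where "e n = (d - c) / 4 * inverse (real (Suc n))" for n
  have e: "e n > 0" "4 * e n \<le> d - c" for n
    using cd(2) mult_left_le[of "inverse (real (Suc n))" "d - c"]
    by (simp_all add: e_def inverse_le_1_iff)
  have "(\<lambda>n. (d - c) / 4 * inverse (real (Suc n))) \<longlonglongrightarrow> (d - c) / 4 * 0"
    by (intro tendsto_mult_left LIMSEQ_inverse_real_of_nat)
  then have e0: "e \<longlonglongrightarrow> 0"
    by (simp add: e_def[abs_def])
  \<comment> \<open>\<open>\<Phi> n\<close> rises on [c + e, c + 2e] and falls on [d - 2e, d - e].
    The gaps of width e keep its support inside (a, b) even if c = a or d = b.\<close>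
  define \<Phi> where "\<Phi> n x = ramp (c + e n) (e n) x - ramp (d - 2 * e n) (e n) x" for n x
  have smooth: "smooth (\<Phi> n)" for n
    unfolding \<Phi>_def[abs_def] by (intro smooth_diff smooth_ramp)
  have "\<Phi> n x = 0" if "x \<notin> {c + e n..d - e n}" for n x
  proof (cases "x < c + e n")
    case True
    then show ?thesis using e[of n] by (simp add: \<Phi>_def ramp_eq_0)
  next
    case False
    then show ?thesis using e[of n] that by (simp add: \<Phi>_def ramp_eq_1)
  qed
  then have test: "test_function a b (\<Phi> n)" for n
    by (rule test_functionI[OF smooth]) (use cd e(1)[of n] in auto)
  have deriv: "deriv (\<Phi> n) x = deriv (ramp (c + e n) (e n)) x - deriv (ramp (d - 2 * e n) (e n)) x"
    for n x unfolding \<Phi>_def[abs_def]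
    by (intro DERIV_imp_deriv DERIV_diff smooth_DERIV smooth_ramp)
  have int: "integrable ?M (\<lambda>x. w x * of_real (deriv (ramp l r) x))" for l r
    by (intro integrable_continuous_Ioo continuous_intros w smooth_continuous_on smooth_deriv
        smooth_ramp)
  have c_lim: "(\<lambda>n. c + e n) \<longlonglongrightarrow> c" "(\<lambda>n. c + 2 * e n) \<longlonglongrightarrow> c" "(\<lambda>n. d - 2 * e n) \<longlonglongrightarrow> d"
    using tendsto_add[OF tendsto_const[of c] e0]
      tendsto_add[OF tendsto_const[of c] tendsto_mult_left[OF e0, of 2]]
      tendsto_diff[OF tendsto_const[of d] tendsto_mult_left[OF e0, of 2]] by auto
  have "(\<lambda>n. (LINT x|?M. w x * of_real (deriv (ramp (c + e n) (e n)) x)) -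
      (LINT x|?M. w x * of_real (deriv (ramp (d - 2 * e n) (e n)) x))) \<longlonglongrightarrow> w c - w d"
  proof (intro tendsto_diff LINT_mult_deriv_ramp_tendsto w e e0 c_lim)
    fix n show "a \<le> c + e n" "c + e n + e n \<le> b" "a \<le> d - 2 * e n" "d - 2 * e n + e n \<le> b"
      using cd e[of n] by auto
  qed (use cd in auto)
  moreover have "(LINT x|?M. w x * of_real (deriv (ramp (c + e n) (e n)) x)) -
      (LINT x|?M. w x * of_real (deriv (ramp (d - 2 * e n) (e n)) x)) =
      - (LINT x|?M. F x * of_real (\<Phi> n x))" for n
  proof -
    have "(LINT x|?M. w x * of_real (deriv (ramp (c + e n) (e n)) x)) -
      (LINT x|?M. w x * of_real (deriv (ramp (d - 2 * e n) (e n)) x)) =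
      (LINT x|?M. w x * of_real (deriv (\<Phi> n) x))"
      by (simp add: deriv right_diff_distrib int)
    also have "\<dots> = - (LINT x|?M. F x * of_real (\<Phi> n x))"
      using wd test unfolding weak_derivative_def by blast
    finally show ?thesis .
  qed
  ultimately have lim1: "(\<lambda>n. - (LINT x|?M. F x * of_real (\<Phi> n x))) \<longlonglongrightarrow> w c - w d"
    by simp
  have "(\<lambda>n. LINT x|?M. F x * of_real (\<Phi> n x)) \<longlonglongrightarrow> (LINT x|?M. F x * indicator {c<..<d} x)"
  proof (rule integral_dominated_convergence[where w = "\<lambda>x. norm (F x)"])
    have "{c<..<d} \<inter> {a<..<b} \<in> sets ?M"
      by (subst sets_restrict_space_iff) auto
    then show "(\<lambda>x. F x * indicator {c<..<d} x) \<in> borel_measurable ?M"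
      using F by (intro borel_measurable_times borel_measurable_indicator') (auto simp: vimage_def Int_def conj_commute)
    show "(\<lambda>x. F x * of_real (\<Phi> n x)) \<in> borel_measurable ?M" for n
      using F borel_measurable_continuous_Ioo[OF smooth_continuous_on[OF smooth]]
      by (intro borel_measurable_times borel_measurable_of_real) auto
    show "integrable ?M (\<lambda>x. norm (F x))" using F by simp
    show "AE x in ?M. (\<lambda>n. F x * of_real (\<Phi> n x)) \<longlonglongrightarrow> F x * indicator {c<..<d} x"
    proof (rule AE_I2)
      fix x
      \<comment> \<open>At each point the sequence is eventually constant: inside (c, d) the point
        is finally between the two ramps, and outside every \<open>\<Phi> n\<close>
        vanishes.\<close>
      have "\<forall>\<^sub>F n in sequentially. \<Phi> n x = indicator {c<..<d} x"
      proof (cases "x \<in> {c<..<d}")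
        case True
        then have "\<forall>\<^sub>F n in sequentially. c + 2 * e n < x" "\<forall>\<^sub>F n in sequentially. x < d - 2 * e n"
          using c_lim by (auto intro: order_tendstoD)
        then show ?thesis
        proof eventually_elim
          case (elim n)
          then show ?case using True e[of n] by (simp add: \<Phi>_def ramp_eq_0 ramp_eq_1)
        qed
      next
        case False
        have "\<Phi> n x = 0" for n
        proof (cases "x \<le> c")
          case True
          then show ?thesis using e[of n] by (simp add: \<Phi>_def ramp_eq_0)
        next
          case False
          then show ?thesis using e[of n] \<open>x \<notin> {c<..<d}\<close> by (simp add: \<Phi>_def ramp_eq_1)
        qed
        then show ?thesis using False by simp
      qed
      then have "\<forall>\<^sub>F n in sequentially. F x * indicator {c<..<d} x = F x * of_real (\<Phi> n x)"
        by eventually_elim (simp add: indicator_def)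
      then show "(\<lambda>n. F x * of_real (\<Phi> n x)) \<longlonglongrightarrow> F x * indicator {c<..<d} x"
        by (rule Lim_transform_eventually[OF tendsto_const])
    qed
    show "AE x in ?M. norm (F x * of_real (\<Phi> n x)) \<le> norm (F x)" for n
    proof (rule AE_I2)
      fix x
      have "\<bar>\<Phi> n x\<bar> \<le> 1"
        using ramp_bounds[of "c + e n" "e n" x] ramp_bounds[of "d - 2 * e n" "e n" x]
        by (simp add: \<Phi>_def)
      then show "norm (F x * of_real (\<Phi> n x)) \<le> norm (F x)"
        by (simp add: norm_mult mult_left_le)
    qed
  qed
  then have "(\<lambda>n. - (LINT x|?M. F x * of_real (\<Phi> n x))) \<longlonglongrightarrow> - (LINT x|?M. F x * indicator {c<..<d} x)"
    by (rule tendsto_minus)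
  from LIMSEQ_unique[OF lim1 this] show ?thesis
    by (simp add: algebra_simps)
qed

text \<open>Test functions are real while the exponential is complex. It is split as E = R + \<i> I,
  the weak derivative is tested against R \<phi> and I \<phi>, and the two identities are
  recombined.\<close>

lemma weak_derivative_exp_mult:
  fixes \<theta> :: complex
  assumes wd: "weak_derivative a b u g" and u: "continuous_on {a..b} u"
    and g: "integrable (lebesgue_on {a<..<b}) g"
  shows "weak_derivative a b (\<lambda>x. exp (\<theta> * of_real x) * u x)
           (\<lambda>x. exp (\<theta> * of_real x) * (g x + \<theta> * u x))"
  unfolding weak_derivative_def
proof (intro allI impI)
  fix \<phi> assume \<phi>: "test_function a b \<phi>"
  let ?M = "lebesgue_on {a<..<b}"
  define E where "E x = exp (\<theta> * of_real x)" for x :: real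
  \<comment> \<open>The cosine is written as a shifted sine, and the zero summands fit the affine
    form of \<open>smooth_affine\<close>.\<close>
  define R where "R x = exp (Re \<theta> * x + 0) * sin (Im \<theta> * x + pi / 2)" for x
  define I where "I x = exp (Re \<theta> * x + 0) * sin (Im \<theta> * x + 0)" for x
  have E_eq: "E x = of_real (R x) + \<i> * of_real (I x)" for x
    by (simp add: E_def R_def I_def complex_eq_iff Re_exp Im_exp sin_add)
  have smooth: "smooth \<phi>" "smooth R" "smooth I"
    subgoal using \<phi> unfolding test_function_iff_smooth by simp
    unfolding R_def[abs_def] I_def[abs_def]
    by (rule smooth_intros(4)[OF smooth_affine[OF smooth_exp] smooth_affine[OF smooth_sin]])+
  have dE: "(E has_vector_derivative \<theta> * E x) (at x)" for x
    unfolding E_def[abs_def]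
    by (auto intro!: derivative_eq_intros has_vector_derivative_real_field simp: mult.commute)
  \<comment> \<open>Uniqueness of the derivative of E identifies R' + \<i> I' with \<theta> E,
    without differentiating R and I explicitly.\<close>
  have "(E has_vector_derivative of_real (deriv R x) + \<i> * of_real (deriv I x)) (at x)" for x
    unfolding E_eq[abs_def]
    by (intro has_vector_derivative_add has_vector_derivative_mult_right
        has_vector_derivative_of_real smooth_DERIV smooth)
  then have E': "\<theta> * E x = of_real (deriv R x) + \<i> * of_real (deriv I x)" for x
    using vector_derivative_unique_at[OF dE] by blast
  have dR: "deriv (\<lambda>x. R x * \<phi> x) x = R x * deriv \<phi> x + deriv R x * \<phi> x" for x
    by (intro DERIV_imp_deriv DERIV_mult' smooth_DERIV smooth)
  have dI: "deriv (\<lambda>x. I x * \<phi> x) x = I x * deriv \<phi> x + deriv I x * \<phi> x" for x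
    by (intro DERIV_imp_deriv DERIV_mult' smooth_DERIV smooth)
  have cont: "continuous_on {a..b} R" "continuous_on {a..b} I" "continuous_on {a..b} \<phi>"
    "continuous_on {a..b} (deriv R)" "continuous_on {a..b} (deriv I)"
    "continuous_on {a..b} (deriv \<phi>)" "continuous_on {a..b} E"
    using smooth smooth_deriv smooth_continuous_on
    by (auto simp: E_def[abs_def] intro!: continuous_intros)
  have iu: "integrable ?M (\<lambda>x. u x * of_real (deriv (\<lambda>x. R x * \<phi> x) x))"
    "integrable ?M (\<lambda>x. \<i> * (u x * of_real (deriv (\<lambda>x. I x * \<phi> x) x)))"
    "integrable ?M (\<lambda>x. E x * u x * of_real (deriv \<phi> x))"
    "integrable ?M (\<lambda>x. \<theta> * E x * u x * of_real (\<phi> x))"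
    unfolding dR dI by (intro integrable_continuous_Ioo continuous_intros cont u)+
  have ig: "integrable ?M (\<lambda>x. g x * of_real (R x * \<phi> x))"
    "integrable ?M (\<lambda>x. \<i> * (g x * of_real (I x * \<phi> x)))"
    "integrable ?M (\<lambda>x. g x * (E x * of_real (\<phi> x)))"
    by (intro integrable_mult_continuous_Ioo g Bochner_Integration.integrable_mult_right
        continuous_intros cont)+
  have "(LINT x|?M. E x * u x * of_real (deriv \<phi> x)) + (LINT x|?M. \<theta> * E x * u x * of_real (\<phi> x))
      = (LINT x|?M. E x * u x * of_real (deriv \<phi> x) + \<theta> * E x * u x * of_real (\<phi> x))"
    using iu by simp
  \<comment> \<open>Both sides integrate u (E \<phi>)': on the left the product rule is applied to
    E, on the right E \<phi> is split into R \<phi> and \<i> I \<phi>.\<close>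
  also have "\<dots> = (LINT x|?M. u x * of_real (deriv (\<lambda>x. R x * \<phi> x) x) +
      \<i> * (u x * of_real (deriv (\<lambda>x. I x * \<phi> x) x)))"
    unfolding E' dR dI by (simp add: E_eq algebra_simps)
  also have "\<dots> = (LINT x|?M. u x * of_real (deriv (\<lambda>x. R x * \<phi> x) x)) +
      \<i> * (LINT x|?M. u x * of_real (deriv (\<lambda>x. I x * \<phi> x) x))"
    using iu by simp
  also have "\<dots> = - (LINT x|?M. g x * of_real (R x * \<phi> x)) +
      \<i> * (- (LINT x|?M. g x * of_real (I x * \<phi> x)))"
    using wd[unfolded weak_derivative_def, rule_format, OF test_function_mult[OF smooth(2) \<phi>]]
      wd[unfolded weak_derivative_def, rule_format, OF test_function_mult[OF smooth(3) \<phi>]]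
    by (simp only:)
  also have "\<dots> = - ((LINT x|?M. g x * of_real (R x * \<phi> x)) +
      (LINT x|?M. \<i> * (g x * of_real (I x * \<phi> x))))"
    by simp
  also have "\<dots> = - (LINT x|?M. g x * of_real (R x * \<phi> x) + \<i> * (g x * of_real (I x * \<phi> x)))"
    using ig by simp
  also have "\<dots> = - (LINT x|?M. g x * (E x * of_real (\<phi> x)))"
    by (simp add: E_eq algebra_simps)
  finally have "(LINT x|?M. E x * u x * of_real (deriv \<phi> x)) =
      - ((LINT x|?M. g x * (E x * of_real (\<phi> x))) + (LINT x|?M. \<theta> * E x * u x * of_real (\<phi> x)))"
    by (simp add: algebra_simps eq_neg_iff_add_eq_0)
  also have "\<dots> = - (LINT x|?M. g x * (E x * of_real (\<phi> x)) + \<theta> * E x * u x * of_real (\<phi> x))"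
    using iu ig by simp
  also have "\<dots> = - (LINT x|?M. E x * (g x + \<theta> * u x) * of_real (\<phi> x))"
    by (simp add: algebra_simps)
  finally show "(LINT x|?M. exp (\<theta> * of_real x) * u x * of_real (deriv \<phi> x)) =
      - (LINT x|?M. exp (\<theta> * of_real x) * (g x + \<theta> * u x) * of_real (\<phi> x))"
    unfolding E_def .
qed

section \<open>The Schur test\<close>

lemma norm_add_powr_le:
  fixes x y :: "'a::real_normed_vector"
  assumes "0 < p"
  shows "norm (x + y) powr p \<le> 2 powr p * (norm x powr p + norm y powr p)"
proof -
  have "norm (x + y) powr p \<le> (2 * max (norm x) (norm y)) powr p"
    using assms norm_triangle_ineq[of x y] by (intro powr_mono2) auto
  also have "\<dots> = 2 powr p * max (norm x) (norm y) powr p"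
    by (simp add: powr_mult)
  also have "\<dots> \<le> 2 powr p * (norm x powr p + norm y powr p)"
    by (intro mult_left_mono) (auto simp: max_def)
  finally show ?thesis .
qed

text \<open>This yields that L^p functions on a bounded interval are integrable.\<close>

lemma le_1_plus_powr:
  fixes x :: real
  assumes "0 \<le> x" "1 \<le> p"
  shows "x \<le> 1 + x powr p"
proof (cases "x \<le> 1")
  case True
  then show ?thesis using powr_ge_zero[of x p] by linarith
next
  case False
  then have "x powr 1 \<le> x powr p" using assms by (intro powr_mono) auto
  then show ?thesis using False by simp
qed

text \<open>Jensen's inequality for the power p and the measure with density k, of total mass C. The
  proof integrates the tangent-line inequality at the weighted mean.\<close>

lemma integral_mult_powr_le:
  fixes k A :: "'a \<Rightarrow> real"
  assumes p: "1 < p" and k: "integrable M k" "\<And>x. x \<in> space M \<Longrightarrow> 0 \<le> k x"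
    and C: "(LINT x|M. k x) = C" "0 < C"
    and A: "\<And>x. x \<in> space M \<Longrightarrow> 0 \<le> A x"
    and kA: "integrable M (\<lambda>x. k x * A x)" "integrable M (\<lambda>x. k x * A x powr p)"
  shows "(LINT x|M. k x * A x) powr p \<le> C powr (p - 1) * (LINT x|M. k x * A x powr p)"
proof -
  define X where "X = (LINT x|M. k x * A x)"
  define Y where "Y = (LINT x|M. k x * A x powr p)"
  have X0: "0 \<le> X"
    unfolding X_def by (intro Bochner_Integration.integral_nonneg) (auto simp: k A)
  have Y0: "0 \<le> Y"
    unfolding Y_def by (intro Bochner_Integration.integral_nonneg) (auto simp: k)
  show ?thesis
  proof (cases "X = 0")
    case True
    then show ?thesis using p Y0 by (simp flip: X_def Y_def)
  next
    case False
    \<comment> \<open>m is the mean of A with respect to the weight k, the point where the tangent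
      is taken.\<close>
    define m where "m = X / C"
    have m: "0 < m" using False X0 C by (simp add: m_def)
    define q where "q = p / (p - 1)"
    have q: "1 < q" "1 / p + 1 / q = 1"
      using p by (auto simp: q_def field_simps)
    \<comment> \<open>The graph of a^p lies above its tangent at m. This is Young's inequality for a
      and m^(p-1) with the conjugate exponent q, as (p - 1) q = p.\<close>
    have tangent: "p * m powr (p - 1) * a \<le> a powr p + (p - 1) * m powr p" if "0 \<le> a" for a
    proof -
      have "a * m powr (p - 1) \<le> a powr p / p + (m powr (p - 1)) powr q / q"
        by (rule Youngs_inequality) (use p q that in auto)
      also have "(m powr (p - 1)) powr q = m powr p"
        using p by (simp add: powr_powr q_def)
      finally have "p * (a * m powr (p - 1)) \<le> p * (a powr p / p + m powr p / q)"
        using p by (intro mult_left_mono) auto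
      moreover have "p * (a powr p / p + m powr p / q) = a powr p + (p - 1) * m powr p"
        using p by (simp add: q_def field_simps)
      ultimately show ?thesis by (simp add: mult_ac)
    qed
    have "p * m powr (p - 1) * X = (LINT x|M. p * m powr (p - 1) * (k x * A x))"
      by (simp add: X_def)
    also have "\<dots> \<le> (LINT x|M. k x * A x powr p + (p - 1) * m powr p * k x)"
    proof (rule integral_mono)
      fix x assume x: "x \<in> space M"
      have "k x * (p * m powr (p - 1) * A x) \<le> k x * (A x powr p + (p - 1) * m powr p)"
        by (intro mult_left_mono tangent A k x)
      then show "p * m powr (p - 1) * (k x * A x) \<le> k x * A x powr p + (p - 1) * m powr p * k x"
        by (simp add: algebra_simps)
    qed (use k kA in auto)
    also have "\<dots> = Y + (p - 1) * m powr p * C"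
      using k kA C by (simp add: Y_def)
    finally have "p * m powr (p - 1) * X \<le> Y + (p - 1) * m powr p * C" .
    \<comment> \<open>Since X = m C, all but one of the p copies of m^p C cancel, leaving m^p C
      \<le> Y.\<close>
    moreover have "p * m powr (p - 1) * X = p * m powr p * C"
    proof -
      have "X = m * C" using C by (simp add: m_def)
      then show ?thesis using m by (simp add: powr_diff)
    qed
    ultimately have "p * m powr p * C \<le> Y + (p - 1) * m powr p * C"
      by (simp only:)
    then have le: "m powr p * C \<le> Y"
      by (simp add: left_diff_distrib)
    have "X powr p = m powr p * C powr p"
      using C X0 m by (simp add: m_def powr_divide)
    also have "\<dots> = C powr (p - 1) * (m powr p * C)"
      using C by (simp add: powr_diff)
    also have "\<dots> \<le> C powr (p - 1) * Y"
      using le by (intro mult_left_mono) auto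
    finally show ?thesis by (simp flip: X_def Y_def)
  qed
qed

text \<open>For each x, Jensen's inequality with weight \<open>K x\<close> costs a factor C^(p-1).
  Integrating in x and exchanging the order of integration brings in the other marginal, which gives
  the last factor C. Boundedness of K on a finite measure space secures the integrability.\<close>

lemma Schur_test:
  fixes K :: "'a \<Rightarrow> 'a \<Rightarrow> real"
  assumes M: "finite_measure M" and p: "1 < p" and C: "0 < C"
    and K[measurable]: "(\<lambda>(x, y). K x y) \<in> borel_measurable (M \<Otimes>\<^sub>M M)"
    and K_bounds: "\<And>x y. x \<in> space M \<Longrightarrow> y \<in> space M \<Longrightarrow> 0 \<le> K x y \<and> K x y \<le> B"
    and K_y: "\<And>x. x \<in> space M \<Longrightarrow> (LINT y|M. K x y) = C"
    and K_x: "\<And>y. y \<in> space M \<Longrightarrow> (LINT x|M. K x y) = C"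
    and A: "\<And>x. 0 \<le> A x" "integrable M A" "integrable M (\<lambda>x. A x powr p)"
    and U: "\<And>x. 0 \<le> U x" "integrable M (\<lambda>x. U x powr p)"
    and le: "\<And>x. x \<in> space M \<Longrightarrow> U x \<le> (LINT y|M. K x y * A y)"
  shows "(LINT x|M. U x powr p) \<le> C powr p * (LINT x|M. A x powr p)"
proof -
  interpret finite_measure M by fact
  interpret pair_sigma_finite M M ..
  have [measurable]: "A \<in> borel_measurable M" using A(2) by simp
  have int_K: "integrable M (\<lambda>y. K x y * f y)"
    if x: "x \<in> space M" and f: "integrable M f" for x and f :: "'a \<Rightarrow> real"
  proof (rule Bochner_Integration.integrable_bound)
    show "integrable M (\<lambda>y. B * f y)" using f by simp
    have [measurable]: "f \<in> borel_measurable M" using f by simp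
    show "(\<lambda>y. K x y * f y) \<in> borel_measurable M" using x by measurable
    show "AE y in M. norm (K x y * f y) \<le> norm (B * f y)"
      using K_bounds[OF x] by (intro AE_I2) (fastforce simp: abs_mult intro!: mult_right_mono)
  qed
  have int_A: "integrable (M \<Otimes>\<^sub>M M) (\<lambda>(x, y). A y powr p)"
    by (rule Fubini_integrable) (use A in \<open>auto intro!: AE_I2\<close>)
  have int_H: "integrable (M \<Otimes>\<^sub>M M) (\<lambda>(x, y). K x y * A y powr p)"
  proof (rule Bochner_Integration.integrable_bound)
    show "integrable (M \<Otimes>\<^sub>M M) (\<lambda>z. B * (case z of (x, y) \<Rightarrow> A y powr p))"
      using int_A by simp
    show "AE z in M \<Otimes>\<^sub>M M. norm (case z of (x, y) \<Rightarrow> K x y * A y powr p)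
        \<le> norm (B * (case z of (x, y) \<Rightarrow> A y powr p))"
      using K_bounds
      by (intro AE_I2) (fastforce simp: abs_mult space_pair_measure intro!: mult_right_mono)
  qed measurable
  have "(LINT x|M. U x powr p) \<le> (LINT x|M. C powr (p - 1) * (LINT y|M. K x y * A y powr p))"
  proof (rule integral_mono)
    show "integrable M (\<lambda>x. C powr (p - 1) * (LINT y|M. K x y * A y powr p))"
      using integrable_fst[OF int_H] by simp
    fix x assume x: "x \<in> space M"
    have "U x powr p \<le> (LINT y|M. K x y * A y) powr p"
      using p U(1) le[OF x] by (intro powr_mono2) auto
    \<comment> \<open>Taking f = 1 in \<open>int_K\<close> gives the integrability of the weight
      itself.\<close>
    also have "\<dots> \<le> C powr (p - 1) * (LINT y|M. K x y * A y powr p)"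
      using int_K[OF x, of "\<lambda>_. 1"] K_bounds[OF x]
      by (intro integral_mult_powr_le p C K_y int_K x A) auto
    finally show "U x powr p \<le> C powr (p - 1) * (LINT y|M. K x y * A y powr p)" .
  qed fact
  also have "\<dots> = C powr (p - 1) * (LINT x|M. (LINT y|M. K x y * A y powr p))"
    by simp
  also have "(LINT x|M. (LINT y|M. K x y * A y powr p)) = (LINT y|M. (LINT x|M. K x y * A y powr p))"
    using Fubini_integral[OF int_H] by simp
  also have "\<dots> = (LINT y|M. C * A y powr p)"
    by (intro Bochner_Integration.integral_cong refl) (simp add: K_x)
  also have "C powr (p - 1) * \<dots> = C powr p * (LINT x|M. A x powr p)"
    using C by (simp add: powr_diff)
  finally show ?thesis .
qed

section \<open>Periodic functions\<close>

lemma Lp_integrable: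
  assumes "u \<in> Lp p a b" "1 \<le> p"
  shows "integrable (lebesgue_on {a<..<b}) u"
proof (rule Bochner_Integration.integrable_bound)
  show "integrable (lebesgue_on {a<..<b}) (\<lambda>x. 1 + cmod (u x) powr p)"
    using assms by (intro Bochner_Integration.integrable_add integrable_const_Ioo) (simp add: Lp_def)
  show "AE x in lebesgue_on {a<..<b}. norm (u x) \<le> norm (1 + cmod (u x) powr p)"
  proof (rule AE_I2)
    fix x
    show "norm (u x) \<le> norm (1 + cmod (u x) powr p)"
      using le_1_plus_powr[of "cmod (u x)" p] assms(2) by simp
  qed
qed (use assms in \<open>simp add: Lp_def\<close>)

lemma Lp_diff_mult:
  assumes "u \<in> Lp p a b" "v \<in> Lp p a b" "0 < p"
  shows "(\<lambda>x. u x - c * v x) \<in> Lp p a b"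
proof -
  let ?M = "lebesgue_on {a<..<b}"
  have [measurable]: "u \<in> borel_measurable ?M" "v \<in> borel_measurable ?M"
    using assms by (auto simp: Lp_def)
  have "integrable ?M (\<lambda>x. cmod (u x - c * v x) powr p)"
  proof (rule Bochner_Integration.integrable_bound)
    show "integrable ?M (\<lambda>x. 2 powr p * (cmod (u x) powr p + cmod c powr p * cmod (v x) powr p))"
      using assms by (simp add: Lp_def)
    show "AE x in ?M. norm (cmod (u x - c * v x) powr p)
        \<le> norm (2 powr p * (cmod (u x) powr p + cmod c powr p * cmod (v x) powr p))"
    proof (rule AE_I2)
      fix x
      show "norm (cmod (u x - c * v x) powr p)
        \<le> norm (2 powr p * (cmod (u x) powr p + cmod c powr p * cmod (v x) powr p))"
        using norm_add_powr_le[OF assms(3), of "u x" "- (c * v x)"]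
        by (simp add: norm_mult powr_mult)
    qed
  qed measurable
  then show ?thesis by (simp add: Lp_def)
qed

lemma Lp_continuous:
  assumes "continuous_on {a..b} u" "0 < p"
  shows "u \<in> Lp p a b"
proof -
  have "continuous_on {a..b} (\<lambda>x. cmod (u x) powr p)"
    using assms by (intro continuous_on_powr' continuous_intros) auto
  then show ?thesis
    using assms by (simp add: Lp_def integrable_continuous_Ioo borel_measurable_continuous_Ioo)
qed

text \<open>Integration by parts, whose boundary terms vanish because \<phi> is zero at both
  endpoints.\<close>

lemma weak_derivative_of_derivative:
  assumes "a \<le> b" "continuous_on {a..b} g"
    and u: "\<And>x. (u has_vector_derivative g x) (at x)"
  shows "weak_derivative a b u g"
  unfolding weak_derivative_def
proof (intro allI impI)
  fix \<phi> assume \<phi>: "test_function a b \<phi>"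
  let ?M = "lebesgue_on {a<..<b}"
  have smooth: "smooth \<phi>" using \<phi> by (simp add: test_function_iff_smooth)
  have cont: "continuous_on {a..b} u" "continuous_on {a..b} \<phi>" "continuous_on {a..b} (deriv \<phi>)"
    using u smooth smooth_deriv
    by (auto intro: smooth_continuous_on continuous_at_imp_continuous_on
        has_vector_derivative_continuous)
  have int: "integrable ?M (\<lambda>x. u x * of_real (deriv \<phi> x))" "integrable ?M (\<lambda>x. g x * of_real (\<phi> x))"
    by (intro integrable_continuous_Ioo continuous_intros cont assms)+
  have "(LINT x|?M. u x * of_real (deriv \<phi> x) + g x * of_real (\<phi> x)) =
      u b * of_real (\<phi> b) - u a * of_real (\<phi> a)"
    by (intro LINT_Ioo_FTC continuous_intros cont assms has_vector_derivative_mult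
        has_vector_derivative_of_real smooth_DERIV smooth)
  also have "\<dots> = 0"
    by (simp add: test_function_eq_0[OF \<phi>])
  finally show "(LINT x|?M. u x * of_real (deriv \<phi> x)) = - (LINT x|?M. g x * of_real (\<phi> x))"
    using int by (simp add: eq_neg_iff_add_eq_0)
qed

section \<open>The kernel on the circle and its marginals\<close>

text \<open>The case \<nu> = 0 is separate because division by zero would give the constant 0. The
  primitive is not normalised at 0, so it enters through differences.\<close>

definition exp_primitive :: "real \<Rightarrow> real \<Rightarrow> real" where
  "exp_primitive \<nu> t = (if \<nu> = 0 then t else exp (\<nu> * t) / \<nu>)"

lemma exp_primitive_DERIV: "(exp_primitive \<nu> has_real_derivative exp (\<nu> * t)) (at t)"
  by (cases "\<nu> = 0") (auto simp: exp_primitive_def[abs_def] intro!: derivative_eq_intros)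

lemma exp_primitive_less: "0 < T \<Longrightarrow> exp_primitive \<nu> 0 < exp_primitive \<nu> T"
  by (rule DERIV_pos_imp_increasing[of 0 T]) (use exp_primitive_DERIV in \<open>auto intro!: exI\<close>)

text \<open>The Green kernel of \<open>\<partial> - \<i>\<alpha>\<close> on the circle of length \<open>T\<close>, in absolute value and up to
  the normalising factor: the integrating factor is carried from \<open>x\<close> forward to \<open>y\<close>, past the
  base point if necessary.\<close>

definition circle_kernel :: "real \<Rightarrow> real \<Rightarrow> real \<Rightarrow> real \<Rightarrow> real" where
  "circle_kernel \<nu> T x y = exp (\<nu> * (if x < y then y - x else y - x + T))"

lemma has_integral_exp_shift:
  assumes "a \<le> b"
  shows "((\<lambda>y. exp (\<nu> * (y + c))) has_integral
           (exp_primitive \<nu> (b + c) - exp_primitive \<nu> (a + c))) {a..b}"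
proof (rule fundamental_theorem_of_calculus[OF assms])
  fix y
  have "((\<lambda>y. exp_primitive \<nu> (y + c)) has_real_derivative exp (\<nu> * (y + c)) * 1) (at y)"
    by (rule DERIV_chain2[OF exp_primitive_DERIV]) (auto intro!: derivative_eq_intros)
  then show "((\<lambda>y. exp_primitive \<nu> (y + c)) has_vector_derivative exp (\<nu> * (y + c)))
      (at y within {a..b})"
    by (simp add: has_real_derivative_iff_has_vector_derivative has_vector_derivative_at_within)
qed

lemma has_integral_exp_reflect:
  assumes "a \<le> b"
  shows "((\<lambda>x. exp (\<nu> * (c - x))) has_integral
           (exp_primitive \<nu> (c - a) - exp_primitive \<nu> (c - b))) {a..b}"
proof -
  have "((\<lambda>x. exp (\<nu> * (c - x))) has_integral
           (- exp_primitive \<nu> (c - b) - - exp_primitive \<nu> (c - a))) {a..b}"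
  proof (rule fundamental_theorem_of_calculus[OF assms])
    fix x
    have "((\<lambda>x. exp_primitive \<nu> (c - x)) has_real_derivative exp (\<nu> * (c - x)) * (-1)) (at x)"
      by (rule DERIV_chain2[OF exp_primitive_DERIV]) (auto intro!: derivative_eq_intros)
    from DERIV_minus[OF this]
    show "((\<lambda>x. - exp_primitive \<nu> (c - x)) has_vector_derivative exp (\<nu> * (c - x)))
        (at x within {a..b})"
      by (simp add: has_real_derivative_iff_has_vector_derivative has_vector_derivative_at_within)
  qed
  then show ?thesis by simp
qed

text \<open>The forward distance covers [T - x, T] as y runs over [0, x], and [0, T - x] as y runs
  over [x, T]; together this is one full turn, whatever x is.\<close>

lemma has_integral_circle_kernel_snd:
  assumes "x \<in> {0..T}"
  shows "((\<lambda>y. circle_kernel \<nu> T x y) has_integral (exp_primitive \<nu> T - exp_primitive \<nu> 0)) {0..T}"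
proof -
  have "((\<lambda>y. circle_kernel \<nu> T x y) has_integral
      (exp_primitive \<nu> (x + (T - x)) - exp_primitive \<nu> (0 + (T - x)))) {0..x}"
    by (rule has_integral_spike[of "{}", OF _ _ has_integral_exp_shift])
       (use assms in \<open>auto simp: circle_kernel_def algebra_simps\<close>)
  moreover have "((\<lambda>y. circle_kernel \<nu> T x y) has_integral
      (exp_primitive \<nu> (T + - x) - exp_primitive \<nu> (x + - x))) {x..T}"
    \<comment> \<open>At y = x the kernel uses distance T instead of 0, so this point is
      excepted.\<close>
    by (rule has_integral_spike[of "{x}", OF _ _ has_integral_exp_shift])
       (use assms in \<open>auto simp: circle_kernel_def algebra_simps\<close>)
  ultimately show ?thesis
    using has_integral_combine[of 0 x T "\<lambda>y. circle_kernel \<nu> T x y"] assms by fastforce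
qed

text \<open>Here the distance covers [0, y] for x in [0, y] and [y, T] for x in [y, T]; the diagonal
  is again the exceptional point.\<close>

lemma has_integral_circle_kernel_fst:
  assumes "y \<in> {0..T}"
  shows "((\<lambda>x. circle_kernel \<nu> T x y) has_integral (exp_primitive \<nu> T - exp_primitive \<nu> 0)) {0..T}"
proof -
  have "((\<lambda>x. circle_kernel \<nu> T x y) has_integral
      (exp_primitive \<nu> (y - 0) - exp_primitive \<nu> (y - y))) {0..y}"
    by (rule has_integral_spike[of "{y}", OF _ _ has_integral_exp_reflect])
       (use assms in \<open>auto simp: circle_kernel_def algebra_simps\<close>)
  moreover have "((\<lambda>x. circle_kernel \<nu> T x y) has_integral
      (exp_primitive \<nu> (y + T - y) - exp_primitive \<nu> (y + T - T))) {y..T}"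
    by (rule has_integral_spike[of "{}", OF _ _ has_integral_exp_reflect])
       (use assms in \<open>auto simp: circle_kernel_def algebra_simps\<close>)
  ultimately show ?thesis
    using has_integral_combine[of 0 y T "\<lambda>x. circle_kernel \<nu> T x y"] assms by fastforce
qed

lemma borel_measurable_circle_kernel:
  "(\<lambda>(x, y). circle_kernel \<nu> T x y) \<in>
     borel_measurable (lebesgue_on S \<Otimes>\<^sub>M lebesgue_on S')"
proof -
  have id: "(\<lambda>x. x) \<in> borel_measurable (lebesgue_on S)" for S :: "real set"
    using id_borel_measurable_lebesgue_on[of S] by (simp add: id_def)
  have [measurable]: "fst \<in> borel_measurable (lebesgue_on S \<Otimes>\<^sub>M lebesgue_on S')"
    "snd \<in> borel_measurable (lebesgue_on S \<Otimes>\<^sub>M lebesgue_on S')"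
    using measurable_compose[OF measurable_fst id] measurable_compose[OF measurable_snd id] by auto
  show ?thesis
    unfolding circle_kernel_def case_prod_beta by measurable
qed

lemma circle_kernel_bounds:
  assumes "x \<in> {0<..<T}" "y \<in> {0<..<T}"
  shows "0 \<le> circle_kernel \<nu> T x y \<and> circle_kernel \<nu> T x y \<le> exp (\<bar>\<nu>\<bar> * T)"
proof -
  let ?t = "if x < y then y - x else y - x + T"
  have "0 \<le> ?t" "?t \<le> T" using assms by auto
  then have "\<nu> * ?t \<le> \<bar>\<nu>\<bar> * T"
    by (intro mult_mono) auto
  then show ?thesis by (simp add: circle_kernel_def)
qed

lemma LINT_circle_kernel:
  assumes "t \<in> {0<..<T}"
  shows "(LINT y|lebesgue_on {0<..<T}. circle_kernel \<nu> T t y) = exp_primitive \<nu> T - exp_primitive \<nu> 0"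
    and "(LINT x|lebesgue_on {0<..<T}. circle_kernel \<nu> T x t) = exp_primitive \<nu> T - exp_primitive \<nu> 0"
proof -
  let ?M = "lebesgue_on {0<..<T}"
  have t: "t \<in> space ?M" using assms by simp
  note [measurable] = borel_measurable_circle_kernel[of \<nu> T "{0<..<T}" "{0<..<T}"]
  have meas: "(\<lambda>y. circle_kernel \<nu> T t y) \<in> borel_measurable ?M"
    "(\<lambda>x. circle_kernel \<nu> T x t) \<in> borel_measurable ?M"
    using t by measurable
  have "integrable ?M (\<lambda>y. circle_kernel \<nu> T t y)"
    by (rule Bochner_Integration.integrable_bound[OF integrable_const_Ioo[of 0 T "exp (\<bar>\<nu>\<bar> * T)"] meas(1)])
       (use circle_kernel_bounds assms in \<open>auto intro!: AE_I2\<close>)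
  then show "(LINT y|?M. circle_kernel \<nu> T t y) = exp_primitive \<nu> T - exp_primitive \<nu> 0"
    by (rule LINT_Ioo_eq) (use assms in \<open>auto intro: has_integral_circle_kernel_snd\<close>)
  have "integrable ?M (\<lambda>x. circle_kernel \<nu> T x t)"
    by (rule Bochner_Integration.integrable_bound[OF integrable_const_Ioo[of 0 T "exp (\<bar>\<nu>\<bar> * T)"] meas(2)])
       (use circle_kernel_bounds assms in \<open>auto intro!: AE_I2\<close>)
  then show "(LINT x|?M. circle_kernel \<nu> T x t) = exp_primitive \<nu> T - exp_primitive \<nu> 0"
    by (rule LINT_Ioo_eq) (use assms in \<open>auto intro: has_integral_circle_kernel_fst\<close>)
qed

section \<open>The lower bound for periodic functions\<close>

lemma periodic_pointwise_bound:
  fixes u g :: "real \<Rightarrow> complex" and \<theta> :: complex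
  assumes wd: "weak_derivative 0 T u g" and u: "continuous_on {0..T} u"
    and g: "integrable (lebesgue_on {0<..<T}) g" and per: "u 0 = u T" and x: "x \<in> {0<..<T}"
  shows "cmod (exp (\<theta> * of_real T) - 1) * cmod (u x) \<le>
    (LINT y|lebesgue_on {0<..<T}. circle_kernel (Re \<theta>) T x y * cmod (g y + \<theta> * u y))"
proof -
  let ?M = "lebesgue_on {0<..<T}"
  define q where "q = exp (\<theta> * of_real T)"
  define w where "w x = exp (\<theta> * of_real x) * u x" for x
  define F where "F y = exp (\<theta> * of_real y) * (g y + \<theta> * u y)" for y
  \<comment> \<open>J is the phase-carrying part of the Green kernel: 1 ahead of x, and q behind x,
    where the path to y passes the base point.\<close>
  define J where "J y = indicator {x<..<T} y + q * indicator {0<..<x} y" for y :: real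
  have f_int: "integrable ?M (\<lambda>y. g y + \<theta> * u y)"
    by (intro Bochner_Integration.integrable_add g integrable_continuous_Ioo continuous_intros u)
  have F_int: "integrable ?M F"
    using integrable_mult_continuous_Ioo[OF f_int, of "\<lambda>y. exp (\<theta> * of_real y)"]
    by (simp add: F_def[abs_def] mult.commute continuous_intros)
  have w: "weak_derivative 0 T w F" "continuous_on {0..T} w"
    unfolding w_def[abs_def] F_def[abs_def]
    by (rule weak_derivative_exp_mult[OF wd u g], intro continuous_intros u)
  have ind[measurable]: "(indicator {c<..<d} :: real \<Rightarrow> complex) \<in> borel_measurable ?M" for c d
    by (rule measurable_restrict_space1, rule borel_measurable_indicator) simp
  have ind_int: "integrable ?M (\<lambda>y. F y * indicator {c<..<d} y)" for c d
    by (rule integrable_mult_bounded_Ioo[OF F_int ind, where B = 1]) (simp add: indicator_def)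
  have "w T = q * w 0"
    using per by (simp add: w_def q_def)
  \<comment> \<open>Both increments are integrals of F; the weight q on the second cancels
    \<open>w 0\<close> against \<open>w T\<close>.\<close>
  then have "(q - 1) * w x = (w T - w x) + q * (w x - w 0)"
    by (simp add: algebra_simps)
  also have "\<dots> = (LINT y|?M. F y * indicator {x<..<T} y) + q * (LINT y|?M. F y * indicator {0<..<x} y)"
    using weak_derivative_FTC[OF w F_int, of x T] weak_derivative_FTC[OF w F_int, of 0 x] x by simp
  also have "\<dots> = (LINT y|?M. F y * indicator {x<..<T} y + q * (F y * indicator {0<..<x} y))"
    using ind_int by simp
  also have "\<dots> = (LINT y|?M. F y * J y)"
    by (simp add: J_def algebra_simps)
  finally have repr: "(q - 1) * w x = (LINT y|?M. F y * J y)" .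
  have J_int: "integrable ?M (\<lambda>y. F y * J y)"
    using ind_int[of x T] Bochner_Integration.integrable_mult_right[OF ind_int[of 0 x], of q]
    by (auto simp: J_def algebra_simps dest: Bochner_Integration.integrable_add)
  have K_int: "integrable ?M (\<lambda>y. circle_kernel (Re \<theta>) T x y * cmod (g y + \<theta> * u y))"
  proof -
    note [measurable] = borel_measurable_circle_kernel[of "Re \<theta>" T "{0<..<T}" "{0<..<T}"]
    have "x \<in> space ?M" using x by simp
    then have "(\<lambda>y. circle_kernel (Re \<theta>) T x y) \<in> borel_measurable ?M" by measurable
    then have "integrable ?M (\<lambda>y. cmod (g y + \<theta> * u y) * circle_kernel (Re \<theta>) T x y)"
      using circle_kernel_bounds[OF x] f_int
      by (intro integrable_mult_bounded_Ioo[where B = "exp (\<bar>Re \<theta>\<bar> * T)"]) auto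
    then show ?thesis by (simp add: mult.commute)
  qed
  have "cmod (q - 1) * cmod (u x) = exp (- (Re \<theta> * x)) * cmod ((q - 1) * w x)"
    unfolding w_def norm_mult by (simp add: exp_minus)
  also have "\<dots> \<le> exp (- (Re \<theta> * x)) * (LINT y|?M. cmod (F y * J y))"
    unfolding repr by (intro mult_left_mono integral_norm_bound) simp
  also have "\<dots> = (LINT y|?M. exp (- (Re \<theta> * x)) * cmod (F y * J y))"
    by simp
  also have "\<dots> \<le> (LINT y|?M. circle_kernel (Re \<theta>) T x y * cmod (g y + \<theta> * u y))"
  proof (rule integral_mono)
    fix y assume "y \<in> space ?M"
    then have y: "0 < y" "y < T" by auto
    have F: "cmod (F y) = exp (Re \<theta> * y) * cmod (g y + \<theta> * u y)"
      by (simp add: F_def norm_mult)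
    \<comment> \<open>Off the diagonal this is an equality, since q has modulus exp(Re \<theta> T).
      At y = x both indicators vanish, so \<open>J y\<close> = 0.\<close>
    have "exp (- (Re \<theta> * x)) * (exp (Re \<theta> * y) * cmod (J y)) \<le> circle_kernel (Re \<theta>) T x y"
    proof (cases x y rule: linorder_cases)
      case less
      then show ?thesis using y by (simp add: J_def circle_kernel_def algebra_simps flip: exp_add)
    next
      case equal
      then show ?thesis by (simp add: J_def circle_kernel_def)
    next
      case greater
      then show ?thesis using y
        by (simp add: J_def circle_kernel_def q_def algebra_simps flip: exp_add)
    qed
    then have "exp (- (Re \<theta> * x)) * (exp (Re \<theta> * y) * cmod (J y)) * cmod (g y + \<theta> * u y)
        \<le> circle_kernel (Re \<theta>) T x y * cmod (g y + \<theta> * u y)"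
      by (rule mult_right_mono) simp
    then show "exp (- (Re \<theta> * x)) * cmod (F y * J y)
        \<le> circle_kernel (Re \<theta>) T x y * cmod (g y + \<theta> * u y)"
      by (simp add: norm_mult F mult_ac)
  qed (use J_int K_int in auto)
  finally show ?thesis unfolding q_def .
qed

lemma periodic_Lp_bound:
  fixes u g :: "real \<Rightarrow> complex" and \<theta> :: complex
  assumes p: "1 < p" and T: "0 < T" and u: "continuous_on {0..T} u" and g: "g \<in> Lp p 0 T"
    and wd: "weak_derivative 0 T u g" and per: "u 0 = u T"
  shows "cmod (exp (\<theta> * of_real T) - 1) powr p * (LINT x|lebesgue_on {0<..<T}. cmod (u x) powr p) \<le>
    (exp_primitive (Re \<theta>) T - exp_primitive (Re \<theta>) 0) powr p *
      (LINT x|lebesgue_on {0<..<T}. cmod (g x + \<theta> * u x) powr p)"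
proof -
  let ?M = "lebesgue_on {0<..<T}"
  let ?q = "exp (\<theta> * of_real T)"
  have uLp: "u \<in> Lp p 0 T" using Lp_continuous[OF u] p by simp
  have f: "(\<lambda>x. g x + \<theta> * u x) \<in> Lp p 0 T"
    using Lp_diff_mult[OF g uLp, of "- \<theta>"] p by simp
  have "(LINT x|?M. (cmod (?q - 1) * cmod (u x)) powr p) \<le>
      (exp_primitive (Re \<theta>) T - exp_primitive (Re \<theta>) 0) powr p *
      (LINT x|?M. cmod (g x + \<theta> * u x) powr p)"
  proof (rule Schur_test[where K = "circle_kernel (Re \<theta>) T" and B = "exp (\<bar>Re \<theta>\<bar> * T)"])
    show "finite_measure ?M" by (rule finite_measure_lebesgue_on[OF lmeasurable_Ioo])
    show "0 < exp_primitive (Re \<theta>) T - exp_primitive (Re \<theta>) 0"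
      using exp_primitive_less[OF T] by simp
    show "integrable ?M (\<lambda>x. (cmod (?q - 1) * cmod (u x)) powr p)"
      using uLp by (simp add: Lp_def powr_mult)
    show "integrable ?M (\<lambda>x. cmod (g x + \<theta> * u x))"
      using Lp_integrable[OF f] p by simp
    show "integrable ?M (\<lambda>x. cmod (g x + \<theta> * u x) powr p)"
      using f by (simp add: Lp_def)
    show "cmod (?q - 1) * cmod (u x) \<le> (LINT y|?M. circle_kernel (Re \<theta>) T x y * cmod (g y + \<theta> * u y))"
      if "x \<in> space ?M" for x
      using that Lp_integrable[OF g] p by (intro periodic_pointwise_bound wd u per) auto
  qed (use p circle_kernel_bounds borel_measurable_circle_kernel LINT_circle_kernel in auto)
  then show ?thesis by (simp add: powr_mult)
qed

section \<open>Evaluation of the constants\<close>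

text \<open>With z = x - \<i> y this is |exp(2z) - 1| = 2 |exp z| |sinh z|, where |sinh z|^2 is the
  sum under the root. It is checked by comparing squares.\<close>

lemma cmod_exp_minus_1:
  "cmod (exp (of_real (2 * x) - \<i> * of_real (2 * y)) - 1) = 2 * exp x * sqrt ((sin y)\<^sup>2 + (sinh x)\<^sup>2)"
proof -
  have 1: "cos (2 * y) = 1 - 2 * (sin y)\<^sup>2"
    by (rule cos_double_sin)
  have 2: "exp (2 * x) = (exp x)\<^sup>2"
    by (simp add: exp_double)
  have "(cmod (exp (of_real (2 * x) - \<i> * of_real (2 * y)) - 1))\<^sup>2 =
      (exp (2 * x) * cos (2 * y) - 1)\<^sup>2 + (exp (2 * x) * sin (2 * y))\<^sup>2"
    by (simp add: cmod_power2 Re_exp Im_exp)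
  also have "\<dots> = (exp (2 * x))\<^sup>2 * ((sin (2 * y))\<^sup>2 + (cos (2 * y))\<^sup>2) - 2 * exp (2 * x) * cos (2 * y) + 1"
    by algebra
  also have "\<dots> = (exp (2 * x))\<^sup>2 - 2 * exp (2 * x) * cos (2 * y) + 1"
    by simp
  also have "\<dots> = 4 * (exp x)\<^sup>2 * ((sin y)\<^sup>2 + (sinh x)\<^sup>2)"
    unfolding 1 2 by (simp add: sinh_def exp_minus power2_eq_square field_simps)
  also have "\<dots> = (2 * exp x * sqrt ((sin y)\<^sup>2 + (sinh x)\<^sup>2))\<^sup>2"
    by (simp add: power_mult_distrib)
  finally show ?thesis by (rule power2_eq_imp_eq) auto
qed

text \<open>The integral of exp(\<nu> s) over [0, 2t] is 2 exp(t \<nu>) sinh(t \<nu>) / \<nu>.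
  Dividing by the reciprocal displays the constant of the theorem, and oddness of sinh allows the
  absolute values.\<close>

lemma exp_primitive_diff_eq:
  "exp_primitive \<nu> (2 * t) - exp_primitive \<nu> 0 =
     2 * exp (t * \<nu>) / (if \<nu> = 0 then 1 / t else \<bar>\<nu>\<bar> / sinh (t * \<bar>\<nu>\<bar>))"
proof (cases "\<nu> = 0")
  case True
  then show ?thesis by (simp add: exp_primitive_def)
next
  case False
  have "sinh (t * \<bar>\<nu>\<bar>) / \<bar>\<nu>\<bar> = sinh (t * \<nu>) / \<nu>"
    by (cases "\<nu> > 0") (use False in \<open>auto simp: abs_if\<close>)
  moreover have "exp (\<nu> * (2 * t)) = exp (t * \<nu>) * exp (t * \<nu>)"
    by (simp flip: exp_add)
  ultimately show ?thesis
    using False by (simp add: exp_primitive_def sinh_def exp_minus field_simps)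
qed

text \<open>The periodic bound is used with \<theta> = -\<i> \<alpha> and T = 2 \<pi>, so that Re
  \<theta> = \<nu>. Both constants then contain the factor 2 exp(\<pi> \<nu>), which
  cancels.\<close>

lemma lambda_inf_quotient_ge:
  assumes p: "1 < p" and \<alpha>: "\<alpha> = of_real \<mu> + \<i> * of_real \<nu>"
    and u: "continuous_on {0..2*pi} u" and g: "g \<in> Lp p 0 (2*pi)"
    and wd: "weak_derivative 0 (2*pi) u g" and per: "u 0 = u (2*pi)"
    and nz: "\<not> (AE x in lebesgue_on {0<..<2*pi}. u x = 0)"
  shows "(if \<nu> = 0 then 1 / pi else \<bar>\<nu>\<bar> / sinh (pi * \<bar>\<nu>\<bar>)) powr p *
           ((sin (pi * \<mu>))\<^sup>2 + (sinh (pi * \<nu>))\<^sup>2) powr (p / 2) \<le>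
         (LINT x|lebesgue_on {0<..<2*pi}. cmod (g x - \<i> * \<alpha> * u x) powr p) /
         (LINT x|lebesgue_on {0<..<2*pi}. cmod (u x) powr p)"
proof -
  let ?M = "lebesgue_on {0<..<2*pi}"
  define s where "s = (if \<nu> = 0 then 1 / pi else \<bar>\<nu>\<bar> / sinh (pi * \<bar>\<nu>\<bar>))"
  define S where "S = (sin (pi * \<mu>))\<^sup>2 + (sinh (pi * \<nu>))\<^sup>2"
  define N where "N = (LINT x|?M. cmod (g x - \<i> * \<alpha> * u x) powr p)"
  define D where "D = (LINT x|?M. cmod (u x) powr p)"
  have s: "0 < s" by (auto simp: s_def)
  have S: "0 \<le> S" by (simp add: S_def)
  \<comment> \<open>A zero denominator would make the quotient 0 by convention; it is excluded
    because u is not zero almost everywhere.\<close>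
  have Dpos: "0 < D"
  proof -
    have "integrable ?M (\<lambda>x. cmod (u x) powr p)"
      using Lp_continuous[OF u, of p] p by (simp add: Lp_def)
    then have "D \<noteq> 0"
      using nz p unfolding D_def by (subst integral_nonneg_eq_0_iff_AE) auto
    moreover have "0 \<le> D" unfolding D_def by simp
    ultimately show ?thesis by simp
  qed
  have \<theta>: "- \<i> * \<alpha> * of_real (2 * pi) = of_real (2 * (pi * \<nu>)) - \<i> * of_real (2 * (pi * \<mu>))"
    by (simp add: \<alpha> algebra_simps)
  have re: "Re (- \<i> * \<alpha>) = \<nu>" by (simp add: \<alpha>)
  have "cmod (exp (- \<i> * \<alpha> * of_real (2 * pi)) - 1) powr p * D \<le>
      (exp_primitive (Re (- \<i> * \<alpha>)) (2 * pi) - exp_primitive (Re (- \<i> * \<alpha>)) 0) powr p * N"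
    using periodic_Lp_bound[OF p _ u g wd per, of "- \<i> * \<alpha>"] by (simp add: D_def N_def)
  then have "(2 * exp (pi * \<nu>) * sqrt S) powr p * D \<le> (2 * exp (pi * \<nu>) / s) powr p * N"
    unfolding re \<theta> cmod_exp_minus_1 exp_primitive_diff_eq by (simp add: S_def s_def)
  also have "(2 * exp (pi * \<nu>) / s) powr p = (2 * exp (pi * \<nu>)) powr p / s powr p"
    using s by (simp add: powr_divide)
  also have "(2 * exp (pi * \<nu>) * sqrt S) powr p = (2 * exp (pi * \<nu>)) powr p * S powr (p / 2)"
    using S by (simp add: powr_mult powr_powr flip: powr_half_sqrt)
  finally have "(2 * exp (pi * \<nu>)) powr p * (s powr p * S powr (p / 2) * D) \<le>
      (2 * exp (pi * \<nu>)) powr p * N"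
    using s by (simp add: field_simps)
  then have "s powr p * S powr (p / 2) * D \<le> N"
    by (rule mult_left_le_imp_le) simp
  then have "s powr p * S powr (p / 2) \<le> N / D"
    using Dpos by (simp add: pos_le_divide_eq)
  then show ?thesis
    unfolding s_def S_def N_def D_def .
qed

section \<open>The upper bound by Fourier modes\<close>

text \<open>For a mode, u' - \<i> \<alpha> u = \<i> (m - \<alpha>) u and |u| = 1. Both integrands
  are constant, so the length of the interval cancels.\<close>

lemma Fourier_mode:
  fixes m :: int and p :: real
  assumes "1 < p"
  defines "u \<equiv> \<lambda>x. exp (\<i> * of_int m * of_real x)"
  defines "g \<equiv> \<lambda>x. \<i> * of_int m * u x"
  shows "u \<in> W1p p 0 (2*pi)" "continuous_on {0..2*pi} u" "g \<in> Lp p 0 (2*pi)"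
    "weak_derivative 0 (2*pi) u g" "\<not> (AE x in lebesgue_on {0<..<2*pi}. u x = 0)"
    "u 0 = u (2*pi)"
    "(LINT x|lebesgue_on {0<..<2*pi}. cmod (g x - \<i> * \<alpha> * u x) powr p) /
       (LINT x|lebesgue_on {0<..<2*pi}. cmod (u x) powr p) = dist \<alpha> (of_int m) powr p"
proof -
  let ?M = "lebesgue_on {0<..<2*pi}"
  show u: "continuous_on {0..2*pi} u"
    unfolding u_def by (intro continuous_intros)
  have g: "continuous_on {0..2*pi} g"
    unfolding g_def by (intro continuous_intros u)
  have "(u has_vector_derivative g x) (at x)" for x
    unfolding g_def u_def
    by (auto intro!: derivative_eq_intros has_vector_derivative_real_field)
  then show wd: "weak_derivative 0 (2*pi) u g"
    by (intro weak_derivative_of_derivative g) auto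
  show gLp: "g \<in> Lp p 0 (2*pi)" using Lp_continuous[OF g] assms by simp
  have uLp: "u \<in> Lp p 0 (2*pi)" using Lp_continuous[OF u] assms by simp
  show "u \<in> W1p p 0 (2*pi)"
    unfolding W1p_def using uLp gLp wd by blast
  have norm_u: "cmod (u x) = 1" for x
    by (simp add: u_def)
  have meas: "measure ?M {0<..<2*pi} = 2 * pi"
    by (simp add: measure_restrict_space)
  show "\<not> (AE x in ?M. u x = 0)"
  proof
    assume "AE x in ?M. u x = 0"
    then have "AE x in ?M. False" by (simp add: u_def)
    then have "emeasure ?M (space ?M) = 0"
      by (simp only: eventually_False ae_filter_eq_bot_iff)
    then have "measure ?M {0<..<2*pi} = 0" by (simp add: measure_def)
    then show False using meas by simp
  qed
  have "exp (\<i> * of_int m * of_real (2 * pi)) = 1"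
    using exp_integer_2pi[of "of_int m"] by (simp add: mult_ac)
  then show "u 0 = u (2*pi)" by (simp add: u_def)
  have "cmod (g x - \<i> * \<alpha> * u x) = dist \<alpha> (of_int m)" for x
  proof -
    have "g x - \<i> * \<alpha> * u x = \<i> * (of_int m - \<alpha>) * u x"
      by (simp add: g_def algebra_simps)
    then show ?thesis by (simp add: norm_mult norm_u dist_norm norm_minus_commute)
  qed
  then show "(LINT x|?M. cmod (g x - \<i> * \<alpha> * u x) powr p) /
       (LINT x|?M. cmod (u x) powr p) = dist \<alpha> (of_int m) powr p"
    by (simp add: norm_u meas)
qed

theorem theorem4p1:
  fixes p \<mu> \<nu> :: real and \<alpha> :: complex
  assumes "1 < p"
    and "\<alpha> = of_real \<mu> + \<i> * of_real \<nu>"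
    and "\<alpha> \<notin> \<int>"
  shows "(if \<nu> = 0 then 1 / pi else \<bar>\<nu>\<bar> / sinh (pi * \<bar>\<nu>\<bar>)) powr p *
           ((sin (pi * \<mu>))\<^sup>2 + (sinh (pi * \<nu>))\<^sup>2) powr (p / 2) \<le> lambda_inf \<alpha> p \<and>
         lambda_inf \<alpha> p \<le> infdist \<alpha> \<int> powr p"
proof -
  let ?M = "lebesgue_on {0<..<2*pi}"
  let ?Q = "{(LINT x|?M. cmod (g x - \<i> * \<alpha> * u x) powr p) / (LINT x|?M. cmod (u x) powr p) | u g.
        u \<in> W1p p 0 (2*pi) \<and> continuous_on {0..2*pi} u \<and>
        g \<in> Lp p 0 (2*pi) \<and> weak_derivative 0 (2*pi) u g \<and>
        \<not> (AE x in ?M. u x = 0) \<and> u 0 = u (2*pi)}"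
  let ?L = "(if \<nu> = 0 then 1 / pi else \<bar>\<nu>\<bar> / sinh (pi * \<bar>\<nu>\<bar>)) powr p *
           ((sin (pi * \<mu>))\<^sup>2 + (sinh (pi * \<nu>))\<^sup>2) powr (p / 2)"
  have lower: "?L \<le> r" if "r \<in> ?Q" for r
    using that lambda_inf_quotient_ge[OF assms(1,2)] by blast
  have mode: "dist \<alpha> (of_int m) powr p \<in> ?Q" for m
    using Fourier_mode[OF assms(1), of m] by (intro CollectI exI conjI) (rule sym, assumption+)
  \<comment> \<open>The integers are closed, so the distance is attained and one mode realises the
    upper bound.\<close>
  obtain z where "z \<in> \<int>" "infdist \<alpha> \<int> = dist \<alpha> z"
    using infdist_attains_inf[of "\<int> :: complex set" \<alpha>] closed_Ints by blast
  then obtain m where m: "infdist \<alpha> \<int> = dist \<alpha> (of_int m)"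
    by (auto elim: Ints_cases)
  \<comment> \<open>On the reals, \<open>Inf\<close> is meaningful for nonempty sets bounded below:
    the modes show that \<open>?Q\<close> is nonempty, and \<open>?L\<close> is a lower
    bound.\<close>
  have "?L \<le> Inf ?Q"
    using mode lower by (intro cInf_greatest) blast+
  moreover have "Inf ?Q \<le> infdist \<alpha> \<int> powr p"
    unfolding m by (intro cInf_lower mode bdd_belowI[of ?Q ?L] lower)
  ultimately show ?thesis
    unfolding lambda_inf_def by blast
qed

end
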